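(* Let $O=(0,0)$ be the origin and suppose $\triangle PQO$ is a triangle in $\mathbb{R}^2$ with $PO\cong QO$ in the taxicab sense, i.e. $d_T(P,O)=d_T(Q,O)$. Write $P=(p_1,p_2)$ and $Q=(q_1,q_2)$. \begin{enumerate} \item If $P$ and $Q$ are in the same quadrant, then $\angle PQO\cong\angle QPO$ if and only if the horizontal component of $P$ equals the vertical component of $Q$ and the horizontal component of $Q$ equals the vertical component of $P$, i.e. $|p_1|=|q_2|$ and $|q_1|=|p_2|$. \item If $P$ and $Q$ are in adjacent quadrants, then $\angle PQO\cong\angle QPO$ if and only if $P$ and $Q$ have equivalent horizontal components and equivalent vertical components, i.e. $|p_1|=|q_1|$ and $|p_2|=|q_2|$. \item If $P$ and $Q$ are in opposing quadrants, then $\angle PQO\cong\angle QPO$. \end{enumerate}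
   Context: The taxicab metric on $\mathbb{R}^2$ is $d_T((x_1,y_1),(x_2,y_2))=|x_1-x_2|+|y_1-y_2|$. The unit taxicab circle about a point $V$ is $\{X: d_T(X,V)=1\}$; it has total taxicab length $8$. The taxicab measure (in $t$-radians) of an angle with vertex $V$ is the taxicab length of the arc that the angle intercepts on the unit taxicab circle about $V$ (for the angles of a triangle, the arc inside the angle, so the measure is less than $4$). Segments are congruent if they have equal taxicab length; angles are congruent ($\cong$) if they have equal taxicab measure. A triangle has three non-collinear vertices, and $\angle PQO$ denotes the angle with vertex $Q$ between rays $QP$ and $QO$. Any part of an axis is considered as included in each of the quadrants to which it is adjacent, so a point may belong to more than one quadrant. Two quadrants are adjacent if they share an axis (I and II, II and III, III and IV, IV and I), and opposing if they are a pair that does not (I and III, II and IV). "$P$ and $Q$ are in adjacent (opposing) quadrants" means that there is a pair of adjacent (opposing) quadrants, one containing $P$ and the other containing $Q$.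
   Formalization: Part 2 is stated only for P and Q in adjacent quadrants that are not also in opposing quadrants; with axes shared it fails otherwise, e.g. for P=(1,0), Q=(0,1), where the angles are congruent but |p1| differs from |q1|. *)

theory Defs
  imports "HOL-Analysis.Analysis"
begin

definition taxi_dist :: "real \<times> real \<Rightarrow> real \<times> real \<Rightarrow> real" where
  "taxi_dist X Y = \<bar>fst X - fst Y\<bar> + \<bar>snd X - snd Y\<bar>"

definition unit_taxi_circle :: "real \<times> real \<Rightarrow> (real \<times> real) set" where
  "unit_taxi_circle V = {X. taxi_dist X V = 1}"

(* Supremum of the taxicab lengths of the inscribed polygons; the list ts holds the
   partition points in increasing order. *)
definition taxi_path_length :: "(real \<Rightarrow> real \<times> real) \<Rightarrow> ereal" where
  "taxi_path_length g =
     (SUP ts \<in> {ts. sorted ts \<and> set ts \<subseteq> {0..1}}.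
        ereal (\<Sum>i<length ts - 1. taxi_dist (g (ts ! i)) (g (ts ! Suc i))))"

(* The length of a simple arc given as a set of points. All injective parametrizations of the
   same arc have the same length, so the choice is immaterial; the value is only meaningful
   if S is an arc. *)
definition taxi_arc_length :: "(real \<times> real) set \<Rightarrow> ereal" where
  "taxi_arc_length S = taxi_path_length (SOME g. arc g \<and> path_image g = S)"

(* The closed region between the rays VA and VB. For A, V, B not collinear it is the convex
   side, so the intercepted arc below is the one inside the angle. *)
definition angle_region ::
    "real \<times> real \<Rightarrow> real \<times> real \<Rightarrow> real \<times> real \<Rightarrow> (real \<times> real) set" where
  "angle_region A V B = {V + a *\<^sub>R (A - V) + b *\<^sub>R (B - V) | a b. 0 \<le> a \<and> 0 \<le> b}"

definition taxi_angle :: "real \<times> real \<Rightarrow> real \<times> real \<Rightarrow> real \<times> real \<Rightarrow> ereal" where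
  "taxi_angle A V B = taxi_arc_length (angle_region A V B \<inter> unit_taxi_circle V)"

datatype quadrant = Quad_I | Quad_II | Quad_III | Quad_IV

(* Closed: an axis belongs to each of the quadrants next to it. *)
fun quadrant_points :: "quadrant \<Rightarrow> (real \<times> real) set" where
  "quadrant_points Quad_I = {X. 0 \<le> fst X \<and> 0 \<le> snd X}"
| "quadrant_points Quad_II = {X. fst X \<le> 0 \<and> 0 \<le> snd X}"
| "quadrant_points Quad_III = {X. fst X \<le> 0 \<and> snd X \<le> 0}"
| "quadrant_points Quad_IV = {X. 0 \<le> fst X \<and> snd X \<le> 0}"

definition adjacent :: "quadrant \<Rightarrow> quadrant \<Rightarrow> bool" where
  "adjacent k l \<longleftrightarrow>
     {k, l} \<in> {{Quad_I, Quad_II}, {Quad_II, Quad_III}, {Quad_III, Quad_IV}, {Quad_IV, Quad_I}}"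

definition opposing :: "quadrant \<Rightarrow> quadrant \<Rightarrow> bool" where
  "opposing k l \<longleftrightarrow> {k, l} \<in> {{Quad_I, Quad_III}, {Quad_II, Quad_IV}}"

definition in_same_quadrant :: "real \<times> real \<Rightarrow> real \<times> real \<Rightarrow> bool" where
  "in_same_quadrant P Q \<longleftrightarrow> (\<exists>k. P \<in> quadrant_points k \<and> Q \<in> quadrant_points k)"

definition in_adjacent_quadrants :: "real \<times> real \<Rightarrow> real \<times> real \<Rightarrow> bool" where
  "in_adjacent_quadrants P Q \<longleftrightarrow>
     (\<exists>k l. adjacent k l \<and> P \<in> quadrant_points k \<and> Q \<in> quadrant_points l)"

definition in_opposing_quadrants :: "real \<times> real \<Rightarrow> real \<times> real \<Rightarrow> bool" where
  "in_opposing_quadrants P Q \<longleftrightarrow>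
     (\<exists>k l. opposing k l \<and> P \<in> quadrant_points k \<and> Q \<in> quadrant_points l)"

end

theory Submission
  imports Defs
begin

text \<open>
  Parametrize the unit taxicab circle by taxicab arc length as \<open>c\<close>, of period 8. A shift of the parameter
  by 2 is a Euclidean quarter turn, and the determinant of \<open>c u\<close>, \<open>c v\<close> is positive for \<open>0 < v - u < 4\<close>;
  so the angle between the directions \<open>c a\<close> and \<open>c b\<close> with \<open>0 < b - a < 4\<close> measures \<open>b - a\<close>.
  Up to exchanging them, the two points are \<open>s c(x)\<close> and \<open>s c(y)\<close> with \<open>0 < y - x < 4\<close>, and the base
  angles are equal iff \<open>c x - c y\<close> is Euclidean-orthogonal to the midpoint \<open>c ((x + y) / 2)\<close> of the arc.
  By the quarter turns one may take \<open>0 \<le> x < 2\<close>, where this is an explicit equation in each of the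
  three possible quadrants of \<open>c y\<close>.
\<close>

lemma taxi_dist_commute: "taxi_dist X Y = taxi_dist Y X"
  by (simp add: taxi_dist_def abs_minus_commute)

subsection \<open>Taxicab length of arcs\<close>

definition taxi_polygon_length :: "(real \<Rightarrow> real \<times> real) \<Rightarrow> real list \<Rightarrow> real" where
  "taxi_polygon_length g ts = (\<Sum>i<length ts - 1. taxi_dist (g (ts ! i)) (g (ts ! Suc i)))"

lemma taxi_path_length_eq_SUP:
  "taxi_path_length g =
     (SUP ts \<in> {ts. sorted ts \<and> set ts \<subseteq> {0..1}}. ereal (taxi_polygon_length g ts))"
  by (simp add: taxi_path_length_def taxi_polygon_length_def)

text \<open>Needed for orientation-reversing reparametrizations, which turn an increasing partition
  into a decreasing one.\<close>

lemma taxi_polygon_length_rev: "taxi_polygon_length g (rev ts) = taxi_polygon_length g ts"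
proof -
  let ?d = "\<lambda>i. taxi_dist (g (ts ! i)) (g (ts ! Suc i))"
  have "taxi_polygon_length g (rev ts) = (\<Sum>i<length ts - 1. ?d (length ts - 1 - Suc i))"
    unfolding taxi_polygon_length_def
  proof (rule sum.cong)
    fix i assume "i \<in> {..<length ts - 1}"
    then have "rev ts ! i = ts ! Suc (length ts - 1 - Suc i)"
      and "rev ts ! Suc i = ts ! (length ts - 1 - Suc i)"
      by (simp_all add: rev_nth Suc_diff_Suc)
    then show "taxi_dist (g (rev ts ! i)) (g (rev ts ! Suc i)) = ?d (length ts - 1 - Suc i)"
      by (simp add: taxi_dist_commute)
  qed simp
  also have "\<dots> = taxi_polygon_length g ts"
    unfolding taxi_polygon_length_def by (rule sum.nat_diff_reindex)
  finally show ?thesis .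
qed

lemma taxi_polygon_length_map: "taxi_polygon_length g (map f ts) = taxi_polygon_length (g \<circ> f) ts"
  unfolding taxi_polygon_length_def by (intro sum.cong) auto

lemma taxi_polygon_length_cong:
  "(\<And>t. t \<in> set ts \<Longrightarrow> g t = h t) \<Longrightarrow> taxi_polygon_length g ts = taxi_polygon_length h ts"
  unfolding taxi_polygon_length_def by (intro sum.cong) auto

text \<open>An arc is a homeomorphism onto its image, so \<open>f\<close> is \<open>h\<close>
  followed by the inverse of \<open>g\<close>. A continuous injection of an interval into the reals
  is monotone.\<close>

lemma arc_reparametrization:
  fixes g h :: "real \<Rightarrow> 'a::t2_space"
  assumes "arc g" "arc h" "path_image g = path_image h"
  obtains f where "f ` {0..1} \<subseteq> {0..1}" "\<And>t. t \<in> {0..1} \<Longrightarrow> g (f t) = h t"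
    "mono_on {0..1} f \<or> antimono_on {0..1} f"
proof -
  obtain k where k: "homeomorphism {0..1} (path_image g) g k"
    using assms(1) homeomorphism_arc by blast
  have h: "continuous_on {0..1} h" "inj_on h {0..1}" "h ` {0..1} = path_image g"
    using assms by (auto simp: arc_def path_def path_image_def)
  have "continuous_on {0..1} (k \<circ> h)"
    using h k by (intro continuous_on_compose) (auto simp: homeomorphism_def)
  moreover have "inj_on (k \<circ> h) {0..1}"
    using h k by (metis comp_inj_on homeomorphism_def inj_on_inverseI)
  ultimately have "mono_on {0..1} (k \<circ> h) \<or> antimono_on {0..1} (k \<circ> h)"
    using injective_eq_monotone_map[of "{0..1}" "k \<circ> h"]
    by (metis is_interval_cc strict_antimono_iff_antimono strict_mono_iff_mono)
  moreover have "(k \<circ> h) ` {0..1} \<subseteq> {0..1}"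
    using h(3) k unfolding image_comp[symmetric] by (simp add: homeomorphism_def)
  moreover have "\<And>t. t \<in> {0..1} \<Longrightarrow> g ((k \<circ> h) t) = h t"
    using h(3) k by (auto simp: homeomorphism_def)
  ultimately show thesis
    using that by blast
qed

text \<open>A polygon inscribed in \<open>h\<close> is inscribed in \<open>g\<close> at the points
  \<open>f\<close> of its partition; if \<open>f\<close> is decreasing, the list is reversed to be
  sorted again.\<close>

lemma taxi_path_length_le_reparametrized:
  assumes "arc g" "arc h" "path_image g = path_image h"
  shows "taxi_path_length h \<le> taxi_path_length g"
proof -
  obtain f where f: "f ` {0..1} \<subseteq> {0..1}" "\<And>t. t \<in> {0..1} \<Longrightarrow> g (f t) = h t"
    "mono_on {0..1} f \<or> antimono_on {0..1} f"
    using arc_reparametrization[OF assms] by blast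
  show ?thesis
    unfolding taxi_path_length_eq_SUP
  proof (rule SUP_mono, clarify)
    fix ts :: "real list" assume ts: "sorted ts" "set ts \<subseteq> {0..1}"
    have len: "taxi_polygon_length g (map f ts) = taxi_polygon_length h ts"
      unfolding taxi_polygon_length_map by (rule taxi_polygon_length_cong) (use f ts in auto)
    have "sorted (map f ts) \<or> sorted (rev (map f ts))"
      using f(3)
    proof
      assume "mono_on {0..1} f"
      then have "mono_on (set ts) f"
        using ts(2) monotone_on_subset by blast
      then show ?thesis
        using ts(1) by (auto simp: sorted_wrt_map monotone_on_def intro: sorted_wrt_mono_rel)
    next
      assume "antimono_on {0..1} f"
      then have "antimono_on (set ts) f"
        using ts(2) monotone_on_subset by blast
      then have "sorted_wrt (\<ge>) (map f ts)"
        using ts(1) by (auto simp: sorted_wrt_map monotone_on_def intro: sorted_wrt_mono_rel)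
      then show ?thesis
        by (simp add: sorted_wrt_rev)
    qed
    then obtain us where us: "us = map f ts \<or> us = rev (map f ts)" "sorted us"
      by blast
    then have "taxi_polygon_length g us = taxi_polygon_length h ts"
      using len by (auto simp: taxi_polygon_length_rev)
    moreover have "set us = f ` set ts"
      using us(1) by auto
    then have "set us \<subseteq> {0..1}"
      using f(1) ts(2) by blast
    ultimately show "\<exists>us\<in>{ts. sorted ts \<and> set ts \<subseteq> {0..1}}.
        ereal (taxi_polygon_length h ts) \<le> ereal (taxi_polygon_length g us)"
      using us(2) by auto
  qed
qed

text \<open>The path chosen by \<open>SOME\<close> and \<open>g\<close> are reparametrizations of
  each other, so the inequality between their lengths holds both ways.\<close>

lemma taxi_arc_length_path_image:
  assumes "arc g"
  shows "taxi_arc_length (path_image g) = taxi_path_length g"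
proof -
  define h where "h = (SOME h. arc h \<and> path_image h = path_image g)"
  have "arc h \<and> path_image h = path_image g"
    unfolding h_def by (rule someI[of _ g]) (use assms in auto)
  then have "taxi_path_length h = taxi_path_length g"
    using assms taxi_path_length_le_reparametrized by (metis antisym)
  then show ?thesis
    by (simp add: taxi_arc_length_def h_def)
qed

subsection \<open>The unit-speed parametrization of the unit taxicab circle\<close>

definition rot90 :: "real \<times> real \<Rightarrow> real \<times> real" where
  "rot90 X = (- snd X, fst X)"

text \<open>The determinant with columns \<open>X\<close> and \<open>Y\<close>; its sign records on
  which side of the line through 0 and \<open>X\<close> the point \<open>Y\<close> lies.\<close>

definition cross2 :: "real \<times> real \<Rightarrow> real \<times> real \<Rightarrow> real" where
  "cross2 X Y = fst X * snd Y - snd X * fst Y"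

text \<open>
  Counterclockwise from \<open>(1, 0)\<close> with taxicab speed 1 and period 8. Composing \<open>arcsin\<close> with \<open>cos\<close> and \<open>sin\<close>
  gives the two triangular waves, with continuity and the quarter-turn symmetry for free.
\<close>
definition taxi_cis :: "real \<Rightarrow> real \<times> real" where
  "taxi_cis t = (2 / pi * arcsin (cos (pi * t / 4)), 2 / pi * arcsin (sin (pi * t / 4)))"

lemma taxi_cis_add_2: "taxi_cis (t + 2) = rot90 (taxi_cis t)"
proof -
  have "pi * (t + 2) / 4 = pi * t / 4 + pi / 2"
    by (simp add: field_simps)
  then have "sin (pi * (t + 2) / 4) = cos (pi * t / 4)"
    and "cos (pi * (t + 2) / 4) = - sin (pi * t / 4)"
    by (simp_all only: sin_add cos_add sin_pi_half cos_pi_half)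
  then show ?thesis
    unfolding taxi_cis_def rot90_def
    by (simp only: fst_conv snd_conv arcsin_minus sin_le_one sin_ge_minus_one mult_minus_right)
qed

lemma taxi_cis_add_4: "taxi_cis (t + 4) = - taxi_cis t"
  using taxi_cis_add_2[of t] taxi_cis_add_2[of "t + 2"]
  by (simp add: rot90_def prod_eq_iff add.assoc)

lemma taxi_cis_add_8: "taxi_cis (t + 8) = taxi_cis t"
  using taxi_cis_add_4[of t] taxi_cis_add_4[of "t + 4"] by (simp add: add.assoc)

lemma taxi_cis_quadrant_I:
  assumes "0 \<le> t" "t \<le> 2"
  shows "taxi_cis t = (1 - t / 2, t / 2)"
proof -
  have t: "0 \<le> pi * t / 4" "pi * t / 4 \<le> pi / 2"
    using assms by (auto simp: field_simps)
  have "arcsin (sin (pi * t / 4)) = pi * t / 4"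
    by (rule arcsin_sin) (use t pi_gt_zero in linarith)+
  moreover have "arcsin (cos (pi * t / 4)) = arcsin (sin (pi / 2 - pi * t / 4))"
    by (simp add: sin_diff)
  moreover have "arcsin (sin (pi / 2 - pi * t / 4)) = pi / 2 - pi * t / 4"
    by (rule arcsin_sin) (use t pi_gt_zero in linarith)+
  ultimately show ?thesis
    by (simp add: taxi_cis_def field_simps)
qed

lemma taxi_cis_quadrant_II: "2 \<le> t \<Longrightarrow> t \<le> 4 \<Longrightarrow> taxi_cis t = (1 - t / 2, 2 - t / 2)"
  using taxi_cis_add_2[of "t - 2"] by (simp add: taxi_cis_quadrant_I rot90_def field_simps)

lemma taxi_cis_quadrant_III: "4 \<le> t \<Longrightarrow> t \<le> 6 \<Longrightarrow> taxi_cis t = (t / 2 - 3, 2 - t / 2)"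
  using taxi_cis_add_4[of "t - 4"] by (simp add: taxi_cis_quadrant_I field_simps)

section \<open>Reduction to the first quadrant by quarter turns\<close>

text \<open>Every real is an even integer away from a point of the interval from 0 to 2. The step is
  an equation, so it can be used for shifts in both directions.\<close>

lemma quarter_turn_induct:
  fixes t :: real
  assumes base: "\<And>u. 0 \<le> u \<Longrightarrow> u < 2 \<Longrightarrow> R u" and step: "\<And>t. R (t + 2) = R t"
  shows "R t"
proof -
  have nat: "R (t + 2 * real n) = R t" for t n
    using step[of "t + 2 * real n" for n] by (induction n) (auto simp: algebra_simps)
  have int: "R (t + 2 * of_int k) = R t" for t k
  proof (cases k rule: int_cases2)
    case (nonneg n)
    then show ?thesis using nat[of t n] by simp
  next
    case (nonpos n)
    then show ?thesis using nat[of "t - 2 * real n" n] by simp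
  qed
  have "R (t - 2 * of_int \<lfloor>t / 2\<rfloor>)"
    by (rule base) linarith+
  then show ?thesis
    using int[of "t - 2 * of_int \<lfloor>t / 2\<rfloor>" "\<lfloor>t / 2\<rfloor>"] by simp
qed

text \<open>In statements about two parameters the quarter turn must act on both; this shifts the
  quantified one along.\<close>

lemma all_shift_2: "(\<forall>v::real. R v) \<longleftrightarrow> (\<forall>v. R (v + 2))"
  by (metis diff_add_cancel)

lemma taxi_dist_rot90: "taxi_dist (rot90 X) (rot90 Y) = taxi_dist X Y"
  by (simp add: taxi_dist_def rot90_def)

lemma cross2_rot90: "cross2 (rot90 X) (rot90 Y) = cross2 X Y"
  by (simp add: cross2_def rot90_def)

lemma taxi_norm_taxi_cis: "\<bar>fst (taxi_cis t)\<bar> + \<bar>snd (taxi_cis t)\<bar> = 1"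
proof (induction t rule: quarter_turn_induct)
  case (1 u)
  then show ?case by (simp add: taxi_cis_quadrant_I)
next
  case (2 t)
  then show ?case by (simp add: taxi_cis_add_2 rot90_def add.commute)
qed

lemma continuous_on_taxi_cis: "continuous_on S taxi_cis"
  unfolding taxi_cis_def by (intro continuous_intros) auto

lemma cross2_taxi_cis_pos:
  assumes "u < v" "v < u + 4"
  shows "0 < cross2 (taxi_cis u) (taxi_cis v)"
proof -
  have "\<forall>v. u < v \<longrightarrow> v < u + 4 \<longrightarrow> 0 < cross2 (taxi_cis u) (taxi_cis v)"
  proof (induction u rule: quarter_turn_induct)
    case (1 u)
    show ?case
    proof (intro allI impI)
      fix v assume v: "u < v" "v < u + 4"
      consider "v \<le> 2" | "2 \<le> v" "v \<le> 4" | "4 \<le> v" by linarith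
      then show "0 < cross2 (taxi_cis u) (taxi_cis v)"
      proof cases
        case 1
        with v \<open>0 \<le> u\<close> show ?thesis
          by (simp add: cross2_def taxi_cis_quadrant_I field_simps)
      next
        case 2
        \<comment> \<open>This is four times the determinant. Both summands are nonnegative, and
          they vanish together only for \<open>u = 0\<close> and \<open>v = 4\<close>, which
          \<open>v < u + 4\<close> excludes.\<close>
        have "0 < (2 - u) * (4 - v) + u * (v - 2)"
        proof (cases "u = 0")
          case False
          then have "0 < u" using \<open>0 \<le> u\<close> by simp
          show ?thesis
          proof (cases "v = 4")
            case False
            then have "0 < (2 - u) * (4 - v)" using 2 \<open>u < 2\<close> by simp
            moreover have "0 \<le> u * (v - 2)" using 2 \<open>0 < u\<close> by simp
            ultimately show ?thesis by linarith
          qed (use \<open>0 < u\<close> in simp)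
        qed (use v in simp)
        with 2 v \<open>0 \<le> u\<close> \<open>u < 2\<close> show ?thesis
          by (simp add: cross2_def taxi_cis_quadrant_I taxi_cis_quadrant_II field_simps)
      next
        case 3
        with v \<open>0 \<le> u\<close> \<open>u < 2\<close> show ?thesis
          by (simp add: cross2_def taxi_cis_quadrant_I taxi_cis_quadrant_III field_simps)
      qed
    qed
  next
    case (2 t)
    show ?case
      by (subst all_shift_2) (simp add: taxi_cis_add_2 cross2_rot90 algebra_simps)
  qed
  then show ?thesis using assms by blast
qed

text \<open>A half turn of the second point changes the sign of the determinant, so on the second
  half of a period it is at most 0.\<close>

lemma cross2_taxi_cis_pos_iff:
  assumes "u \<le> v" "v < u + 8"
  shows "0 < cross2 (taxi_cis u) (taxi_cis v) \<longleftrightarrow> u < v \<and> v < u + 4"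
proof
  assume pos: "0 < cross2 (taxi_cis u) (taxi_cis v)"
  have "cross2 (taxi_cis u) (taxi_cis v) = - cross2 (taxi_cis u) (taxi_cis (v - 4))"
    using taxi_cis_add_4[of "v - 4"] by (simp add: cross2_def)
  moreover have "0 \<le> cross2 (taxi_cis u) (taxi_cis (v - 4))" if "u + 4 \<le> v"
    using that assms cross2_taxi_cis_pos[of u "v - 4"] by (cases "v = u + 4") (auto simp: cross2_def)
  moreover have "u \<noteq> v"
    using pos by (auto simp: cross2_def)
  ultimately show "u < v \<and> v < u + 4"
    using pos assms by linarith
qed (use cross2_taxi_cis_pos in blast)

lemma inj_on_taxi_cis:
  assumes "b < a + 4"
  shows "inj_on taxi_cis {a..b}"
proof (rule linorder_inj_onI)
  fix u v assume "u < v" "u \<in> {a..b}" "v \<in> {a..b}"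
  then show "taxi_cis u \<noteq> taxi_cis v"
    using assms cross2_taxi_cis_pos[of u v] by (auto simp: cross2_def)
qed auto

lemma taxi_cis_surj:
  assumes "\<bar>x\<bar> + \<bar>y\<bar> = 1"
  obtains t where "a \<le> t" "t < a + 8" "taxi_cis t = (x, y)"
proof -
  consider "0 \<le> x" "0 \<le> y" | "x \<le> 0" "0 \<le> y" | "x \<le> 0" "y \<le> 0" | "0 \<le> x" "y \<le> 0"
    by linarith
  \<comment> \<open>The witnesses solve the linear formula of each quadrant for the parameter; the
    fourth quadrant is the half turn of the second.\<close>
  then have start: "\<exists>t. 0 \<le> t \<and> t \<le> 8 \<and> taxi_cis t = (x, y)"
  proof cases
    case 1
    with assms show ?thesis
      by (intro exI[of _ "2 * y"]) (auto simp: taxi_cis_quadrant_I)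
  next
    case 2
    with assms show ?thesis
      by (intro exI[of _ "2 - 2 * x"]) (auto simp: taxi_cis_quadrant_II field_simps)
  next
    case 3
    with assms show ?thesis
      by (intro exI[of _ "4 - 2 * y"]) (auto simp: taxi_cis_quadrant_III field_simps)
  next
    case 4
    with assms show ?thesis
      using taxi_cis_add_4[of "2 + 2 * x"]
      by (intro exI[of _ "6 + 2 * x"]) (auto simp: taxi_cis_quadrant_II algebra_simps)
  qed
  have "\<exists>t. a \<le> t \<and> t < a + 8 \<and> taxi_cis t = (x, y)"
  proof (induction a rule: quarter_turn_induct)
    case (1 u)
    obtain t where t: "0 \<le> t" "t \<le> 8" "taxi_cis t = (x, y)"
      using start by blast
    show ?case
    proof (cases "u \<le> t \<and> t < u + 8")
      case False
      \<comment> \<open>A \<open>t\<close> below the window is moved up by a period; the only other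
        failure is the right end 8, where the half-open window from 0 contains 0 instead.\<close>
      consider "t < u" | "t = 8" "u = 0"
        using False t 1 by linarith
      then show ?thesis
      proof cases
        case 1
        with t \<open>u < 2\<close> show ?thesis by (intro exI[of _ "t + 8"]) (auto simp: taxi_cis_add_8)
      next
        case 2
        then show ?thesis
          using t taxi_cis_add_8[of 0] by (intro exI[of _ 0]) auto
      qed
    qed (use t in blast)
  next
    case (2 a)
    \<comment> \<open>The windows from \<open>a\<close> and from \<open>a + 2\<close> differ by a
      piece of length 2 at each end, and a period carries one piece to the other.\<close>
    show ?case
    proof
      assume "\<exists>t. a + 2 \<le> t \<and> t < a + 2 + 8 \<and> taxi_cis t = (x, y)"
      then obtain t where "a + 2 \<le> t" "t < a + 2 + 8" "taxi_cis t = (x, y)" by blast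
      then show "\<exists>t. a \<le> t \<and> t < a + 8 \<and> taxi_cis t = (x, y)"
        using taxi_cis_add_8[of "t - 8"]
        by (cases "t < a + 8"; intro exI[of _ "if t < a + 8 then t else t - 8"]) auto
    next
      assume "\<exists>t. a \<le> t \<and> t < a + 8 \<and> taxi_cis t = (x, y)"
      then obtain t where "a \<le> t" "t < a + 8" "taxi_cis t = (x, y)" by blast
      then show "\<exists>t. a + 2 \<le> t \<and> t < a + 2 + 8 \<and> taxi_cis t = (x, y)"
        using taxi_cis_add_8[of t]
        by (cases "a + 2 \<le> t"; intro exI[of _ "if a + 2 \<le> t then t else t + 8"]) auto
    qed
  qed
  with that show thesis by blast
qed

subsection \<open>Angles as differences of parameters\<close>

text \<open>By Cramer's rule the coefficients of \<open>X\<close> in the basis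
  \<open>taxi_cis a\<close>, \<open>taxi_cis b\<close> are quotients of determinants by a positive
  one, so lying in the cone is a condition on two signs.\<close>

lemma cone_inter_taxi_circle:
  assumes "a < b" "b < a + 4"
  shows "{\<alpha> *\<^sub>R taxi_cis a + \<beta> *\<^sub>R taxi_cis b | \<alpha> \<beta>. 0 \<le> \<alpha> \<and> 0 \<le> \<beta>} \<inter> {X. \<bar>fst X\<bar> + \<bar>snd X\<bar> = 1}
    = taxi_cis ` {a..b}"
proof (intro equalityI subsetI)
  let ?d = "cross2 (taxi_cis a) (taxi_cis b)"
  have d: "0 < ?d"
    using assms cross2_taxi_cis_pos by blast
  fix X
  {
    assume "X \<in> {\<alpha> *\<^sub>R taxi_cis a + \<beta> *\<^sub>R taxi_cis b | \<alpha> \<beta>. 0 \<le> \<alpha> \<and> 0 \<le> \<beta>} \<inter> {X. \<bar>fst X\<bar> + \<bar>snd X\<bar> = 1}"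
    then obtain \<alpha> \<beta> where X: "X = \<alpha> *\<^sub>R taxi_cis a + \<beta> *\<^sub>R taxi_cis b" "0 \<le> \<alpha>" "0 \<le> \<beta>"
      "\<bar>fst X\<bar> + \<bar>snd X\<bar> = 1" by blast
    obtain t where t: "a \<le> t" "t < a + 8" "taxi_cis t = X"
      using taxi_cis_surj[OF X(4), of a] by auto
    have at: "cross2 (taxi_cis a) (taxi_cis t) = \<beta> * ?d"
      and tb: "cross2 (taxi_cis t) (taxi_cis b) = \<alpha> * ?d"
      unfolding t(3) X(1) by (simp_all add: cross2_def algebra_simps)
    \<comment> \<open>Between \<open>b\<close> and \<open>b + 4\<close> the sign of \<alpha> would
      be wrong. From \<open>b + 4\<close> on, \<beta> would have to be 0, although the determinant
      with \<open>taxi_cis a\<close> is strictly negative there.\<close>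
    have "t \<le> b"
    proof (rule ccontr)
      assume "\<not> t \<le> b"
      have "\<not> t < b + 4"
      proof
        assume "t < b + 4"
        then have "0 < cross2 (taxi_cis b) (taxi_cis t)"
          using \<open>\<not> t \<le> b\<close> cross2_taxi_cis_pos[of b t] by simp
        then show False
          using tb d X(2) by (smt (verit) cross2_def mult.commute mult_nonneg_nonneg)
      qed
      then have "\<not> 0 < cross2 (taxi_cis a) (taxi_cis t)"
        using cross2_taxi_cis_pos_iff[of a t] t assms by simp
      then have "\<beta> = 0"
        using at d X(3) by (smt (verit) mult_pos_pos)
      moreover have "0 < cross2 (taxi_cis a) (taxi_cis (t - 4))"
        using cross2_taxi_cis_pos[of a "t - 4"] \<open>\<not> t < b + 4\<close> t assms by simp
      ultimately show False
        using at taxi_cis_add_4[of "t - 4"] by (simp add: cross2_def)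
    qed
    with t show "X \<in> taxi_cis ` {a..b}" by auto
  next
    assume "X \<in> taxi_cis ` {a..b}"
    then obtain t where t: "a \<le> t" "t \<le> b" "X = taxi_cis t" by auto
    have cramer: "?d *\<^sub>R X = cross2 X (taxi_cis b) *\<^sub>R taxi_cis a + cross2 (taxi_cis a) X *\<^sub>R taxi_cis b"
      by (simp add: prod_eq_iff cross2_def algebra_simps)
    have "X = (1 / ?d) *\<^sub>R (?d *\<^sub>R X)"
      using d by simp
    also have "\<dots> = (cross2 X (taxi_cis b) / ?d) *\<^sub>R taxi_cis a + (cross2 (taxi_cis a) X / ?d) *\<^sub>R taxi_cis b"
      unfolding cramer by (simp add: scaleR_right_distrib)
    finally have "X = (cross2 X (taxi_cis b) / ?d) *\<^sub>R taxi_cis a + (cross2 (taxi_cis a) X / ?d) *\<^sub>R taxi_cis b" .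
    moreover have "0 \<le> cross2 X (taxi_cis b)"
      using t assms cross2_taxi_cis_pos[of t b] by (cases "t = b") (auto simp: cross2_def)
    moreover have "0 \<le> cross2 (taxi_cis a) X"
      using t assms cross2_taxi_cis_pos[of a t] by (cases "t = a") (auto simp: cross2_def)
    ultimately show "X \<in> {\<alpha> *\<^sub>R taxi_cis a + \<beta> *\<^sub>R taxi_cis b | \<alpha> \<beta>. 0 \<le> \<alpha> \<and> 0 \<le> \<beta>}
        \<inter> {X. \<bar>fst X\<bar> + \<bar>snd X\<bar> = 1}"
      using d t(3) taxi_norm_taxi_cis[of t] by (auto intro!: divide_nonneg_pos)
  }
qed

section \<open>Length of arcs of the unit taxicab circle\<close>

text \<open>Each coordinate changes at rate 1/2, so a chord is at most as long as its parameter
  interval.\<close>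

lemma taxi_dist_taxi_cis_le:
  assumes "u \<le> v" "v < u + 4"
  shows "taxi_dist (taxi_cis u) (taxi_cis v) \<le> v - u"
proof -
  have "\<forall>v. u \<le> v \<longrightarrow> v < u + 4 \<longrightarrow> taxi_dist (taxi_cis u) (taxi_cis v) \<le> v - u"
  proof (induction u rule: quarter_turn_induct)
    case (1 u)
    show ?case
    proof (intro allI impI)
      fix v assume v: "u \<le> v" "v < u + 4"
      consider "v \<le> 2" | "2 \<le> v" "v \<le> 4" | "4 \<le> v" "v \<le> 6"
        using v 1 by linarith
      then show "taxi_dist (taxi_cis u) (taxi_cis v) \<le> v - u"
        by cases (use v 1 in \<open>simp_all add: taxi_dist_def taxi_cis_quadrant_I taxi_cis_quadrant_II
            taxi_cis_quadrant_III abs_if field_simps\<close>)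
    qed
  next
    case (2 t)
    show ?case
      by (subst all_shift_2) (simp add: taxi_cis_add_2 taxi_dist_rot90 algebra_simps)
  qed
  with assms show ?thesis by blast
qed

text \<open>A parameter interval shorter than 4 meets at most two corners after its start, and
  between corners both coordinates are monotone. Thus an inscribed polygon with at most three sides
  attains the full length.\<close>

lemma taxi_cis_corners:
  assumes "a \<le> b" "b < a + 4"
  obtains m n where "a \<le> m" "m \<le> n" "n \<le> b"
    "taxi_dist (taxi_cis a) (taxi_cis m) = m - a"
    "taxi_dist (taxi_cis m) (taxi_cis n) = n - m"
    "taxi_dist (taxi_cis n) (taxi_cis b) = b - n"
proof -
  let ?R = "\<lambda>a b m n. a \<le> m \<and> m \<le> n \<and> n \<le> b \<and> taxi_dist (taxi_cis a) (taxi_cis m) = m - a \<and>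
    taxi_dist (taxi_cis m) (taxi_cis n) = n - m \<and> taxi_dist (taxi_cis n) (taxi_cis b) = b - n"
  have "\<forall>b. a \<le> b \<longrightarrow> b < a + 4 \<longrightarrow> (\<exists>m n. ?R a b m n)"
  proof (induction a rule: quarter_turn_induct)
    case (1 a)
    show ?case
    proof (intro allI impI)
      fix b assume b: "a \<le> b" "b < a + 4"
      consider "b \<le> 2" | "2 \<le> b" "b \<le> 4" | "4 \<le> b" "b \<le> 6"
        using b 1 by linarith
      \<comment> \<open>The possible corners are at 2 and 4; one beyond \<open>b\<close> is replaced
        by \<open>b\<close> and gives a degenerate side.\<close>
      then have "?R a b (min 2 b) (min 4 b)"
        by cases (use b 1 in \<open>simp_all add: taxi_dist_def taxi_cis_quadrant_I taxi_cis_quadrant_II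
            taxi_cis_quadrant_III\<close>)
      then show "\<exists>m n. ?R a b m n" by blast
    qed
  next
    case (2 t)
    have ex: "(\<exists>v::real. R v) \<longleftrightarrow> (\<exists>v. R (v + 2))" for R
      by (metis diff_add_cancel)
    show ?case
      by (subst all_shift_2, subst ex, subst (2) ex)
        (simp add: taxi_cis_add_2 taxi_dist_rot90 algebra_simps)
  qed
  with assms that show thesis by blast
qed

lemma taxi_dist_translate: "taxi_dist (V + X) (V + Y) = taxi_dist X Y"
  by (simp add: taxi_dist_def)

text \<open>The chord bound telescopes to give the upper estimate for every polygon; the polygon
  through the corners attains it.\<close>

lemma taxi_path_length_taxi_cis:
  assumes "a < b" "b < a + 4"
  shows "taxi_path_length (\<lambda>s. V + taxi_cis (linepath a b s)) = ereal (b - a)"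
proof -
  let ?g = "\<lambda>s. V + taxi_cis (linepath a b s)"
  have lp: "linepath a b s = a + s * (b - a)" for s
    by (simp add: linepath_def algebra_simps)
  have mono: "linepath a b s \<le> linepath a b t" if "s \<le> t" for s t
    using assms that by (simp add: lp)
  have range: "a \<le> linepath a b s" "linepath a b s \<le> b" if "0 \<le> s" "s \<le> 1" for s
    using mono[of 0 s] mono[of s 1] that by (simp_all add: lp)
  have "taxi_polygon_length ?g ts \<le> b - a" if ts: "sorted ts" "set ts \<subseteq> {0..1}" for ts
  \<comment> \<open>The telescoped sum refers to the first and last partition points, which only a
    nonempty list has.\<close>
  proof (cases "ts = []")
    case False
    have "taxi_polygon_length ?g ts \<le> (\<Sum>i<length ts - 1. linepath a b (ts ! Suc i) - linepath a b (ts ! i))"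
      unfolding taxi_polygon_length_def
    proof (rule sum_mono)
      fix i assume "i \<in> {..<length ts - 1}"
      then have i: "i < length ts" "Suc i < length ts"
        by auto
      then have "ts ! i \<in> {0..1}" "ts ! Suc i \<in> {0..1}" "ts ! i \<le> ts ! Suc i"
        using ts nth_mem by (blast, blast, auto simp: sorted_iff_nth_mono)
      then show "taxi_dist (?g (ts ! i)) (?g (ts ! Suc i)) \<le> linepath a b (ts ! Suc i) - linepath a b (ts ! i)"
        unfolding taxi_dist_translate
        using assms range[of "ts ! i"] range[of "ts ! Suc i"] mono
        by (intro taxi_dist_taxi_cis_le) auto
    qed
    also have "\<dots> = linepath a b (ts ! (length ts - 1)) - linepath a b (ts ! 0)"
      by (rule sum_lessThan_telescope)
    also have "ts ! (length ts - 1) \<in> {0..1}" "ts ! 0 \<in> {0..1}"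
      using False ts(2) by (auto simp del: atLeastAtMost_iff intro!: subsetD[OF ts(2)])
    then have "linepath a b (ts ! (length ts - 1)) - linepath a b (ts ! 0) \<le> b - a"
      using range[of "ts ! (length ts - 1)"] range[of "ts ! 0"] by auto
    finally show ?thesis .
  qed (use assms in \<open>simp add: taxi_polygon_length_def\<close>)
  moreover have "\<exists>ts. sorted ts \<and> set ts \<subseteq> {0..1} \<and> taxi_polygon_length ?g ts = b - a"
  proof -
    obtain m n where mn: "a \<le> m" "m \<le> n" "n \<le> b"
      "taxi_dist (taxi_cis a) (taxi_cis m) = m - a"
      "taxi_dist (taxi_cis m) (taxi_cis n) = n - m"
      "taxi_dist (taxi_cis n) (taxi_cis b) = b - n"
      using taxi_cis_corners[of a b] assms by auto
    \<comment> \<open>The inverse of \<open>linepath a b\<close>, turning circle parameters into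
      partition points of the unit interval.\<close>
    define p where "p v = (v - a) / (b - a)" for v
    have p: "linepath a b (p v) = v" for v
      using assms by (simp add: p_def lp)
    let ?ts = "[p a, p m, p n, p b]"
    have "sorted ?ts \<and> set ?ts \<subseteq> {0..1}"
      using mn assms by (auto simp: p_def divide_right_mono)
    moreover have "taxi_polygon_length ?g ?ts = b - a"
      using mn by (simp add: taxi_polygon_length_def taxi_dist_translate p eval_nat_numeral)
    ultimately show ?thesis by blast
  qed
  ultimately show ?thesis
    unfolding taxi_path_length_eq_SUP
    by (intro antisym SUP_least) (auto intro!: SUP_upper2)
qed

text \<open>Positive factors do not change rays, so the angle region is the translated cone. It cuts
  the circle in a translated arc, injectively parametrized because \<open>b - a\<close> is less than
  4.\<close>

lemma taxi_angle_taxi_cis: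
  assumes "a < b" "b < a + 4" "0 < r" "0 < s"
    and A: "A - V = r *\<^sub>R taxi_cis a" and B: "B - V = s *\<^sub>R taxi_cis b"
  shows "taxi_angle A V B = ereal (b - a)"
proof -
  let ?g = "\<lambda>s. V + taxi_cis (linepath a b s)"
  let ?C = "{\<alpha> *\<^sub>R taxi_cis a + \<beta> *\<^sub>R taxi_cis b | \<alpha> \<beta>. 0 \<le> \<alpha> \<and> 0 \<le> \<beta>}"
  have "angle_region A V B = (+) V ` ?C"
  proof (intro equalityI subsetI)
    fix X assume "X \<in> angle_region A V B"
    then obtain \<alpha> \<beta> where "0 \<le> \<alpha>" "0 \<le> \<beta>"
      "X = V + ((\<alpha> * r) *\<^sub>R taxi_cis a + (\<beta> * s) *\<^sub>R taxi_cis b)"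
      by (auto simp: angle_region_def A B add.assoc)
    moreover from this have "0 \<le> \<alpha> * r" "0 \<le> \<beta> * s"
      using assms by simp_all
    ultimately show "X \<in> (+) V ` ?C"
      by blast
  next
    fix X assume "X \<in> (+) V ` ?C"
    then obtain \<alpha> \<beta> where "0 \<le> \<alpha>" "0 \<le> \<beta>"
      "X = V + (\<alpha> / r) *\<^sub>R (A - V) + (\<beta> / s) *\<^sub>R (B - V)"
      using assms by (auto simp: A B add.assoc)
    moreover from this have "0 \<le> \<alpha> / r" "0 \<le> \<beta> / s"
      using assms by simp_all
    ultimately show "X \<in> angle_region A V B"
      unfolding angle_region_def by blast
  qed
  moreover have "unit_taxi_circle V = (+) V ` {X. \<bar>fst X\<bar> + \<bar>snd X\<bar> = 1}"
  proof (intro equalityI subsetI)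
    fix X assume "X \<in> unit_taxi_circle V"
    then show "X \<in> (+) V ` {X. \<bar>fst X\<bar> + \<bar>snd X\<bar> = 1}"
      by (intro image_eqI[of _ _ "X - V"]) (auto simp: unit_taxi_circle_def taxi_dist_def)
  qed (auto simp: unit_taxi_circle_def taxi_dist_def)
  ultimately have "angle_region A V B \<inter> unit_taxi_circle V = (+) V ` taxi_cis ` {a..b}"
    using cone_inter_taxi_circle[OF assms(1,2)] by (simp flip: image_Int)
  also have "\<dots> = path_image ?g"
  proof -
    have "path_image (linepath a b) = {a..b}"
      using assms by (simp add: closed_segment_eq_real_ivl)
    then show ?thesis
      by (simp add: path_image_def image_image flip: \<open>path_image (linepath a b) = {a..b}\<close>)
  qed
  finally have "taxi_angle A V B = taxi_arc_length (path_image ?g)"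
    by (simp add: taxi_angle_def)
  moreover have "arc ?g"
  proof -
    have "arc (linepath a b)"
      using assms by (intro arc_linepath) simp
    then have lp: "inj_on (linepath a b) {0..1}" "linepath a b ` {0..1} = {a..b}"
      using assms path_image_linepath[of a b] by (auto simp: arc_def path_image_def closed_segment_eq_real_ivl)
    have "inj_on (taxi_cis \<circ> linepath a b) {0..1}"
      using lp inj_on_taxi_cis[OF assms(2)] by (simp add: comp_inj_on)
    moreover have "continuous_on {0..1} (taxi_cis \<circ> linepath a b)"
      by (intro continuous_on_compose continuous_on_taxi_cis continuous_on_linepath)
    ultimately show ?thesis
      by (auto simp: arc_def path_def inj_on_def comp_def intro!: continuous_intros)
  qed
  ultimately show ?thesis
    using taxi_arc_length_path_image taxi_path_length_taxi_cis[OF assms(1,2)] by simp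
qed

lemma taxi_angle_commute: "taxi_angle A V B = taxi_angle B V A"
proof -
  have "angle_region A V B \<subseteq> angle_region B V A" for A B
    unfolding angle_region_def by (auto simp: ac_simps) (metis add.commute add.left_commute)
  then have "angle_region A V B = angle_region B V A"
    by blast
  then show ?thesis
    by (simp add: taxi_angle_def)
qed

text \<open>
  If \<open>taxi_cis z\<close> is the direction of \<open>taxi_cis x - taxi_cis y\<close> with \<open>y + 4 < z < x + 8\<close>, the two angles
  measure \<open>z - (y + 4)\<close> and \<open>(x + 8) - z\<close>. They agree iff \<open>z = (x + y) / 2 + 6\<close>, and
  \<open>taxi_cis (m + 6)\<close> is \<open>taxi_cis m\<close> turned by a Euclidean right angle.
\<close>
lemma taxi_angle_eq_iff_orthogonal:
  assumes "x < y" "y < x + 4" "0 < s"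
  shows "taxi_angle (s *\<^sub>R taxi_cis x) (s *\<^sub>R taxi_cis y) 0 = taxi_angle (s *\<^sub>R taxi_cis y) (s *\<^sub>R taxi_cis x) 0
    \<longleftrightarrow> (taxi_cis x - taxi_cis y) \<bullet> taxi_cis ((x + y) / 2) = 0"
proof -
  let ?D = "taxi_cis x - taxi_cis y"
  let ?m = "(x + y) / 2"
  let ?n = "\<bar>fst ?D\<bar> + \<bar>snd ?D\<bar>"
  have xy: "0 < cross2 (taxi_cis x) (taxi_cis y)"
    using assms cross2_taxi_cis_pos by simp
  then have "?D \<noteq> 0"
    by (auto simp: cross2_def)
  then have n: "0 < ?n"
    by (auto simp: prod_eq_iff)
  then have "\<bar>fst ?D / ?n\<bar> + \<bar>snd ?D / ?n\<bar> = 1"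
    by (simp flip: add_divide_distrib)
  then obtain z where z: "y + 4 \<le> z" "z < y + 4 + 8" "taxi_cis z = (fst ?D / ?n, snd ?D / ?n)"
    by (rule taxi_cis_surj)
  then have D: "?D = ?n *\<^sub>R taxi_cis z"
    using n by (simp add: prod_eq_iff)
  define n where "n = ?n"
  then have n: "0 < n" and D: "?D = n *\<^sub>R taxi_cis z"
    using n D by simp_all
  \<comment> \<open>Seen from the vertex \<open>s *\<^sub>R taxi_cis y\<close>, the origin lies in
    direction \<open>y + 4\<close>; the determinant shows that \<open>z\<close> is less than a half
    turn ahead of it.\<close>
  have "n * cross2 (taxi_cis (y + 4)) (taxi_cis z) = cross2 (taxi_cis (y + 4)) ?D"
    unfolding D by (simp add: cross2_def algebra_simps)
  also have "\<dots> = cross2 (taxi_cis x) (taxi_cis y)"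
    by (simp add: taxi_cis_add_4 cross2_def algebra_simps)
  finally have "0 < cross2 (taxi_cis (y + 4)) (taxi_cis z)"
    using xy n by (metis zero_less_mult_pos)
  then have z1: "y + 4 < z" "z < y + 8"
    using cross2_taxi_cis_pos_iff[OF z(1,2)] by auto
  \<comment> \<open>The opposite sign against \<open>x + 8\<close>, the direction of
    \<open>x\<close> one period later, bounds \<open>z\<close> from above.\<close>
  have "n * cross2 (taxi_cis (x + 8)) (taxi_cis z) = cross2 (taxi_cis x) ?D"
    unfolding D by (simp add: taxi_cis_add_8 cross2_def algebra_simps)
  also have "\<dots> = - cross2 (taxi_cis x) (taxi_cis y)"
    by (simp add: cross2_def algebra_simps)
  finally have "cross2 (taxi_cis (x + 8)) (taxi_cis z) < 0"
    using xy n by (smt (verit) mult_nonneg_nonneg)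
  then have z2: "z < x + 8"
    using cross2_taxi_cis_pos[of "x + 8" z] z1 assms
    by (cases z "x + 8" rule: linorder_cases) (auto simp: cross2_def)
  have "taxi_angle 0 (s *\<^sub>R taxi_cis y) (s *\<^sub>R taxi_cis x) = ereal (z - (y + 4))"
  proof (rule taxi_angle_taxi_cis)
    show "s *\<^sub>R taxi_cis x - s *\<^sub>R taxi_cis y = (s * n) *\<^sub>R taxi_cis z"
      using D by (metis scaleR_diff_right scaleR_scaleR)
    show "0 - s *\<^sub>R taxi_cis y = s *\<^sub>R taxi_cis (y + 4)"
      by (simp add: taxi_cis_add_4)
  qed (use z1 n assms in auto)
  \<comment> \<open>At the other vertex the ray along the base points opposite to \<open>?D\<close>,
    in direction \<open>z - 4\<close>, and the origin lies in direction
    \<open>x + 4\<close>.\<close>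
  moreover have "taxi_angle (s *\<^sub>R taxi_cis y) (s *\<^sub>R taxi_cis x) 0 = ereal (x + 4 - (z - 4))"
  proof (rule taxi_angle_taxi_cis)
    have "s *\<^sub>R taxi_cis y - s *\<^sub>R taxi_cis x = - (s *\<^sub>R ?D)"
      by (simp add: scaleR_diff_right)
    also have "\<dots> = (s * n) *\<^sub>R taxi_cis (z - 4)"
      unfolding D using taxi_cis_add_4[of "z - 4"] by simp
    finally show "s *\<^sub>R taxi_cis y - s *\<^sub>R taxi_cis x = (s * n) *\<^sub>R taxi_cis (z - 4)" .
    show "0 - s *\<^sub>R taxi_cis x = s *\<^sub>R taxi_cis (x + 4)"
      by (simp add: taxi_cis_add_4)
  qed (use z1 z2 n assms in auto)
  ultimately have "taxi_angle (s *\<^sub>R taxi_cis x) (s *\<^sub>R taxi_cis y) 0 = taxi_angle (s *\<^sub>R taxi_cis y) (s *\<^sub>R taxi_cis x) 0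
      \<longleftrightarrow> z = ?m + 6"
    by (subst taxi_angle_commute) (auto simp: field_simps)
  \<comment> \<open>Both parameters are less than a half turn apart, so their directions are
    parallel only if they coincide.\<close>
  also have "\<dots> \<longleftrightarrow> cross2 (taxi_cis (?m + 6)) (taxi_cis z) = 0"
  proof
    assume "cross2 (taxi_cis (?m + 6)) (taxi_cis z) = 0"
    moreover have "cross2 (taxi_cis z) (taxi_cis (?m + 6)) = - cross2 (taxi_cis (?m + 6)) (taxi_cis z)"
      by (simp add: cross2_def)
    moreover have "z < ?m + 6 + 4" "?m + 6 < z + 4"
      using z1 z2 assms by (auto simp: field_simps)
    ultimately show "z = ?m + 6"
      using cross2_taxi_cis_pos[of "?m + 6" z] cross2_taxi_cis_pos[of z "?m + 6"]
      by (cases z "?m + 6" rule: linorder_cases) auto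
  qed (simp add: cross2_def)
  also have "cross2 (taxi_cis (?m + 6)) (taxi_cis z) = taxi_cis z \<bullet> taxi_cis ?m"
    using taxi_cis_add_4[of "?m + 2"] taxi_cis_add_2[of ?m]
    by (simp add: cross2_def rot90_def inner_prod_def add.assoc)
  also have "\<dots> = 0 \<longleftrightarrow> ?D \<bullet> taxi_cis ?m = 0"
    unfolding D using n by simp
  finally show ?thesis .
qed

subsection \<open>The criterion in terms of components\<close>

text \<open>
  The three claims of the theorem with \<open>E\<close> for the congruence of the angles and with the quadrants
  expressed by the signs of the products of components, which makes the invariance under quarter
  turns evident.
\<close>
definition component_criterion :: "real \<times> real \<Rightarrow> real \<times> real \<Rightarrow> bool \<Rightarrow> bool" where
  "component_criterion X Y E \<longleftrightarrow>
     (0 \<le> fst X * fst Y \<and> 0 \<le> snd X * snd Y \<longrightarrow>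
        (E \<longleftrightarrow> \<bar>fst X\<bar> = \<bar>snd Y\<bar> \<and> \<bar>fst Y\<bar> = \<bar>snd X\<bar>)) \<and>
     (fst X * fst Y \<le> 0 \<and> 0 < snd X * snd Y \<or> 0 < fst X * fst Y \<and> snd X * snd Y \<le> 0 \<longrightarrow>
        (E \<longleftrightarrow> \<bar>fst X\<bar> = \<bar>fst Y\<bar> \<and> \<bar>snd X\<bar> = \<bar>snd Y\<bar>)) \<and>
     (fst X * fst Y \<le> 0 \<and> snd X * snd Y \<le> 0 \<longrightarrow> E)"

lemma component_criterion_taxi_cis:
  assumes "x < y" "y < x + 4"
  shows "component_criterion (taxi_cis x) (taxi_cis y)
    ((taxi_cis x - taxi_cis y) \<bullet> taxi_cis ((x + y) / 2) = 0)"
proof -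
  let ?E = "\<lambda>x y. (taxi_cis x - taxi_cis y) \<bullet> taxi_cis ((x + y) / 2)"
  have "\<forall>y. x < y \<longrightarrow> y < x + 4 \<longrightarrow> component_criterion (taxi_cis x) (taxi_cis y) (?E x y = 0)"
  proof (induction x rule: quarter_turn_induct)
    case (1 x)
    show ?case
    proof (intro allI impI)
      fix y assume y: "x < y" "y < x + 4"
      note x = \<open>0 \<le> x\<close> \<open>x < 2\<close>
      have X: "taxi_cis x = (1 - x / 2, x / 2)"
        using x by (simp add: taxi_cis_quadrant_I)
      consider "y \<le> 2" | "2 < y" "y \<le> 4" | "4 < y" by linarith
      then show "component_criterion (taxi_cis x) (taxi_cis y) (?E x y = 0)"
      proof cases
        case 1
        have Y: "taxi_cis y = (1 - y / 2, y / 2)"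
          using x y 1 by (simp add: taxi_cis_quadrant_I)
        have "?E x y = (y - x) * (2 - x - y) / 4"
          using x y 1 unfolding X Y by (subst taxi_cis_quadrant_I) (auto simp: inner_prod_def field_simps)
        then have E: "?E x y = 0 \<longleftrightarrow> x + y = 2"
          using y by (simp only:) auto
        show ?thesis
          using x y 1 unfolding component_criterion_def E unfolding X Y
          by (auto simp: zero_le_mult_iff mult_le_0_iff zero_less_mult_iff)
      next
        case 2
        have Y: "taxi_cis y = (1 - y / 2, 2 - y / 2)"
          using x y 2 by (simp add: taxi_cis_quadrant_II)
        \<comment> \<open>The solution \<open>x + y = 4\<close> is reflection in the vertical axis.
          For \<open>x = 0\<close> or \<open>y = 4\<close> a point lies on the horizontal axis, and
          the pair is also opposing.\<close>
        have E: "?E x y = 0 \<longleftrightarrow> x + y = 4 \<or> x = 0 \<or> y = 4"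
        \<comment> \<open>This decides whether the midpoint of the arc lies in the first or the
          second quadrant.\<close>
        proof (cases "x + y \<le> 4")
          case True
          then have "?E x y = - x * (4 - x - y) / 4"
            using x y unfolding X Y by (subst taxi_cis_quadrant_I) (auto simp: inner_prod_def field_simps)
          then show ?thesis
            using x y True by auto
        next
          case False
          then have "?E x y = (4 - y) * (x + y - 4) / 4"
            using x y 2 unfolding X Y by (subst taxi_cis_quadrant_II) (auto simp: inner_prod_def field_simps)
          then show ?thesis
            using x y 2 False by auto
        qed
        have "fst (taxi_cis x) * fst (taxi_cis y) < 0"
          unfolding X Y fst_conv using x 2 by (intro mult_pos_neg) auto
        moreover have "snd (taxi_cis x) * snd (taxi_cis y) \<le> 0 \<longleftrightarrow> x = 0 \<or> y = 4"
          unfolding X Y snd_conv using x 2 by (auto simp: mult_le_0_iff)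
        moreover have "x + y = 4 \<longleftrightarrow> \<bar>fst (taxi_cis x)\<bar> = \<bar>fst (taxi_cis y)\<bar> \<and> \<bar>snd (taxi_cis x)\<bar> = \<bar>snd (taxi_cis y)\<bar>"
          unfolding X Y fst_conv snd_conv using x 2 by linarith
        ultimately show ?thesis
          unfolding component_criterion_def E by auto
      next
        case 3
        have Y: "taxi_cis y = (y / 2 - 3, 2 - y / 2)"
          using x y 3 by (simp add: taxi_cis_quadrant_III)
        \<comment> \<open>Here the midpoint lies in the second quadrant and the expression vanishes
          identically.\<close>
        have "?E x y = 0"
          using x y 3 unfolding X Y by (subst taxi_cis_quadrant_II) (auto simp: inner_prod_def field_simps)
        moreover have "fst (taxi_cis x) * fst (taxi_cis y) < 0" "snd (taxi_cis x) * snd (taxi_cis y) < 0"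
          unfolding X Y fst_conv snd_conv using x y 3 by (auto intro!: mult_pos_neg)
        ultimately show ?thesis
          by (simp add: component_criterion_def)
      qed
    qed
  next
    case (2 x)
    have mid: "(x + 2 + (y + 2)) / 2 = (x + y) / 2 + 2" for y
      by (simp add: field_simps)
    have inner: "(rot90 X - rot90 Y) \<bullet> rot90 M = (X - Y) \<bullet> M" for X Y M
      by (simp add: rot90_def inner_prod_def algebra_simps)
    \<comment> \<open>The turn exchanges the two products of components, which permutes the
      conditions within each clause.\<close>
    have rot: "component_criterion (rot90 X) (rot90 Y) E = component_criterion X Y E" for X Y E
      unfolding component_criterion_def rot90_def fst_conv snd_conv minus_mult_minus abs_minus_cancel
        eq_commute[of "\<bar>snd X\<bar>" "\<bar>fst Y\<bar>"] eq_commute[of "\<bar>snd Y\<bar>" "\<bar>fst X\<bar>"]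
      by blast
    show ?case
      by (subst all_shift_2) (simp only: mid taxi_cis_add_2 inner rot, simp add: add.commute)
  qed
  with assms show ?thesis by blast
qed

section \<open>Quadrants as sign conditions on products\<close>

lemma ex_quadrant: "(\<exists>k. R k) \<longleftrightarrow> R Quad_I \<or> R Quad_II \<or> R Quad_III \<or> R Quad_IV"
  by (metis quadrant.exhaust)

text \<open>A closed quadrant is an independent choice of a weak sign for each coordinate, and two
  reals admit a common weak sign iff their product is nonnegative.\<close>

lemma in_same_quadrant_iff:
  "in_same_quadrant X Y \<longleftrightarrow> 0 \<le> fst X * fst Y \<and> 0 \<le> snd X * snd Y"
  unfolding in_same_quadrant_def ex_quadrant by (simp add: zero_le_mult_iff) argo

lemma in_opposing_quadrants_iff:
  "in_opposing_quadrants X Y \<longleftrightarrow> fst X * fst Y \<le> 0 \<and> snd X * snd Y \<le> 0"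
  unfolding in_opposing_quadrants_def ex_quadrant opposing_def
  by (simp add: mult_le_0_iff doubleton_eq_iff) argo

lemma in_adjacent_quadrants_iff:
  "in_adjacent_quadrants X Y \<longleftrightarrow>
     fst X * fst Y \<le> 0 \<and> 0 \<le> snd X * snd Y \<or> 0 \<le> fst X * fst Y \<and> snd X * snd Y \<le> 0"
  unfolding in_adjacent_quadrants_def ex_quadrant adjacent_def
  by (simp add: mult_le_0_iff zero_le_mult_iff doubleton_eq_iff) argo

text \<open>Excluding opposing pairs makes one product strictly positive. With a point on an axis a
  pair can be both adjacent and opposing, and then the angles agree although the components may
  differ.\<close>

lemma component_criterion_iff:
  "component_criterion X Y E \<longleftrightarrow>
     (in_same_quadrant X Y \<longrightarrow> (E \<longleftrightarrow> \<bar>fst X\<bar> = \<bar>snd Y\<bar> \<and> \<bar>fst Y\<bar> = \<bar>snd X\<bar>)) \<and>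
     (in_adjacent_quadrants X Y \<and> \<not> in_opposing_quadrants X Y \<longrightarrow>
        (E \<longleftrightarrow> \<bar>fst X\<bar> = \<bar>fst Y\<bar> \<and> \<bar>snd X\<bar> = \<bar>snd Y\<bar>)) \<and>
     (in_opposing_quadrants X Y \<longrightarrow> E)"
proof -
  have "in_adjacent_quadrants X Y \<and> \<not> in_opposing_quadrants X Y \<longleftrightarrow>
    fst X * fst Y \<le> 0 \<and> 0 < snd X * snd Y \<or> 0 < fst X * fst Y \<and> snd X * snd Y \<le> 0"
    unfolding in_adjacent_quadrants_iff in_opposing_quadrants_iff by linarith
  then show ?thesis
    by (simp only: component_criterion_def in_same_quadrant_iff in_opposing_quadrants_iff)
qed

lemma component_criterion_commute: "component_criterion X Y E \<longleftrightarrow> component_criterion Y X E"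
  unfolding component_criterion_def mult.commute[of "fst Y"] mult.commute[of "snd Y"]
    eq_commute[of "\<bar>fst Y\<bar>" "\<bar>fst X\<bar>"] eq_commute[of "\<bar>snd Y\<bar>" "\<bar>snd X\<bar>"]
  by blast

lemma component_criterion_scaleR:
  assumes "0 < s"
  shows "component_criterion (s *\<^sub>R X) (s *\<^sub>R Y) E \<longleftrightarrow> component_criterion X Y E"
proof -
  have prod: "s * a * (s * b) = s\<^sup>2 * (a * b)" for a b
    by (simp add: power2_eq_square)
  show ?thesis
    unfolding component_criterion_def fst_scaleR snd_scaleR real_scaleR_def prod
    using assms by (simp add: abs_mult zero_le_mult_iff[of "s\<^sup>2"] mult_le_0_iff[of "s\<^sup>2"] zero_less_mult_iff[of "s\<^sup>2"])
qed

lemma component_criterion_taxi_angle: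
  assumes "x < y" "y < x + 4" "0 < s" "P = s *\<^sub>R taxi_cis x" "Q = s *\<^sub>R taxi_cis y"
  shows "component_criterion P Q (taxi_angle P Q 0 = taxi_angle Q P 0)"
  using component_criterion_taxi_cis[OF assms(1,2)] assms(3)
  unfolding assms(4,5) taxi_angle_eq_iff_orthogonal[OF assms(1-3)]
  by (simp add: component_criterion_scaleR)

theorem proposition4p2:
  fixes p1 p2 q1 q2 :: real and P Q Z :: "real \<times> real"
  assumes "P = (p1, p2)" and "Q = (q1, q2)" and "Z = (0, 0)"
    and triangle: "\<not> collinear {P, Q, Z}"
    and "taxi_dist P Z = taxi_dist Q Z"
  shows "(in_same_quadrant P Q \<longrightarrow>
            (taxi_angle P Q Z = taxi_angle Q P Z \<longleftrightarrow> \<bar>p1\<bar> = \<bar>q2\<bar> \<and> \<bar>q1\<bar> = \<bar>p2\<bar>))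
       \<and> (in_adjacent_quadrants P Q \<and> \<not> in_opposing_quadrants P Q \<longrightarrow>
            (taxi_angle P Q Z = taxi_angle Q P Z \<longleftrightarrow> \<bar>p1\<bar> = \<bar>q1\<bar> \<and> \<bar>p2\<bar> = \<bar>q2\<bar>))
       \<and> (in_opposing_quadrants P Q \<longrightarrow> taxi_angle P Q Z = taxi_angle Q P Z)"
proof -
  have Z: "Z = 0"
    using assms by (simp add: zero_prod_def)
  define s where "s = \<bar>p1\<bar> + \<bar>p2\<bar>"
  have sq: "s = \<bar>q1\<bar> + \<bar>q2\<bar>"
    using assms by (simp add: taxi_dist_def s_def)
  have "P \<noteq> 0"
    using triangle Z collinear_2 by (auto simp: insert_commute)
  then have s: "0 < s"
    using assms by (auto simp: s_def zero_prod_def)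
  have polar: "\<exists>t\<ge>a. t < a + 8 \<and> X = s *\<^sub>R taxi_cis t" if "\<bar>fst X\<bar> + \<bar>snd X\<bar> = s" for X a
  proof -
    have "\<bar>fst X / s\<bar> + \<bar>snd X / s\<bar> = 1"
      using that s by (simp flip: add_divide_distrib)
    then obtain t where "a \<le> t" "t < a + 8" "taxi_cis t = (fst X / s, snd X / s)"
      by (rule taxi_cis_surj)
    with s show ?thesis
      by (intro exI[of _ t]) (simp add: prod_eq_iff)
  qed
  obtain x where x: "P = s *\<^sub>R taxi_cis x"
    using polar[of P 0] assms(1) by (auto simp: s_def)
  obtain y where y: "x \<le> y" "y < x + 8" "Q = s *\<^sub>R taxi_cis y"
    using polar[of Q x] assms(2) sq by auto
  have "y \<noteq> x"
    using triangle collinear_2 x y by (auto simp: insert_commute)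
  moreover have "y \<noteq> x + 4"
  proof
    assume "y = x + 4"
    then have "Q = - P"
      using x y by (simp add: taxi_cis_add_4)
    then have "collinear {0, P, Q}"
      by (metis collinear_lemma scaleR_minus1_left)
    then show False
      using triangle Z by (simp add: insert_commute)
  qed
  \<comment> \<open>Collinearity excludes the differences 0 and 4. If \<open>y - x\<close> exceeds
    4, the short way runs from \<open>y\<close> to \<open>x + 8\<close>, and the two points exchange
    roles.\<close>
  ultimately consider "x < y" "y < x + 4" | "y < x + 8" "x + 8 < y + 4"
    using y by linarith
  then have "component_criterion P Q (taxi_angle P Q Z = taxi_angle Q P Z)"
  proof cases
    case 1
    then show ?thesis
      unfolding Z using component_criterion_taxi_angle s x y by blast
  next
    case 2
    moreover have "P = s *\<^sub>R taxi_cis (x + 8)"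
      by (simp add: x taxi_cis_add_8)
    ultimately have "component_criterion Q P (taxi_angle Q P Z = taxi_angle P Q Z)"
      unfolding Z using component_criterion_taxi_angle s y by blast
    then show ?thesis
      unfolding component_criterion_commute[of Q P]
        eq_commute[of "taxi_angle Q P Z" "taxi_angle P Q Z"] .
  qed
  then show ?thesis
    unfolding component_criterion_iff using assms by simp
qed

end
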